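(* Let $n \ge 2$ be an integer. For $k\ge 0$ let $f_n(k)$ be the number of lower $k$-coloured decorated sweep covers (lower $k$-DSCs) in the infinite $n$-ary tree poset, and let $F_n(z)=\sum_{k\ge 0} f_n(k)z^k$ be their ordinary generating function. Then, as formal power series, \[ F_n(z) = \sum_{u=0}^n \binom{n}{u} B_u(z)\, F_n(z)^{n - u}, \] where $B_u(z) = \sum_{k=0}^u {u \brace k} z^k$ is the $u$-th Touchard polynomial and ${u \brace k}$ denotes the Stirling number of the second kind.
   Context: In a poset, $p$ covers $q$ if $q<p$ and there is no $r$ with $q<r<p$. The elements covered by $p$ are its children, the elements covering $p$ are its parents, and elements having a common parent are siblings. The infinite $n$-ary tree poset is the poset with a maximum element (the root) $p_0$ whose Hasse diagram is the infinite rooted tree in which every element has exactly $n$ children (equivalently: finite words over an $n$-letter alphabet, with $p\ge q$ iff $p$ is a prefix of $q$). An antichain is a set of pairwise incomparable elements; it is maximal if every element not in it is comparable to at least one of its elements. A decorated sweep cover (DSC) with exactly $k$ colours ($k$-DSC) is a colouring $c:S\to\mathcal K$ of a maximal antichain $S$, using all $k$ colours of a $k$-element set $\mathcal K$, such that any two distinct $p,q\in S$ with $c(p)=c(q)$ are siblings; DSCs are counted up to permutation of the colours (so a $k$-DSC amounts to a maximal antichain $S$ with a partition of $S$ into $k$ nonempty blocks of mutual siblings). A lower DSC is one whose antichain is not the singleton $\{p_0\}$ of the root. *)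

theory Defs
  imports
    "HOL-Library.Sublist"
    "HOL-Library.FuncSet"
    "HOL-Combinatorics.Stirling"
    "HOL-Combinatorics.Permutations"
    "HOL-Computational_Algebra.Polynomial_FPS"
begin

(* A poset is a reflexive relation r with Partial_order r; its carrier is Field r,
   and (q, p) \<in> r means q \<le> p. *)

definition covers :: "'a rel \<Rightarrow> 'a \<Rightarrow> 'a \<Rightarrow> bool" where
  "covers r p q \<longleftrightarrow> (q, p) \<in> r \<and> q \<noteq> p \<and>
     \<not> (\<exists>s. (q, s) \<in> r \<and> q \<noteq> s \<and> (s, p) \<in> r \<and> s \<noteq> p)"

definition siblings :: "'a rel \<Rightarrow> 'a \<Rightarrow> 'a \<Rightarrow> bool" where
  "siblings r p q \<longleftrightarrow> (\<exists>s. covers r s p \<and> covers r s q)"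

definition comparable :: "'a rel \<Rightarrow> 'a \<Rightarrow> 'a \<Rightarrow> bool" where
  "comparable r p q \<longleftrightarrow> (p, q) \<in> r \<or> (q, p) \<in> r"

definition antichain :: "'a rel \<Rightarrow> 'a set \<Rightarrow> bool" where
  "antichain r S \<longleftrightarrow> S \<subseteq> Field r \<and> (\<forall>p\<in>S. \<forall>q\<in>S. p \<noteq> q \<longrightarrow> \<not> comparable r p q)"

definition maximal_antichain :: "'a rel \<Rightarrow> 'a set \<Rightarrow> bool" where
  "maximal_antichain r S \<longleftrightarrow> antichain r S \<and> (\<forall>p \<in> Field r - S. \<exists>q\<in>S. comparable r p q)"

definition DSC :: "'a rel \<Rightarrow> 'c set \<Rightarrow> 'a set \<Rightarrow> ('a \<Rightarrow> 'c) \<Rightarrow> bool" where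
  "DSC r K S c \<longleftrightarrow> maximal_antichain r S \<and> c \<in> S \<rightarrow>\<^sub>E K \<and> c ` S = K \<and>
     (\<forall>p\<in>S. \<forall>q\<in>S. p \<noteq> q \<and> c p = c q \<longrightarrow> siblings r p q)"

(* The colourings are extensional outside S, so that equality of pairs (S, c) is equality of
   colourings on S. *)
definition recolouring :: "'c set \<Rightarrow> ('a set \<times> ('a \<Rightarrow> 'c)) set \<Rightarrow> ('a set \<times> ('a \<Rightarrow> 'c)) rel" where
  "recolouring K X = {((S, c), (T, d)). (S, c) \<in> X \<and> (T, d) \<in> X \<and> S = T \<and>
     (\<exists>\<pi>. \<pi> permutes K \<and> (\<forall>x\<in>S. d x = \<pi> (c x)))}"

lemma equiv_recolouring: "equiv X (recolouring K X)"
proof (rule equivI)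
  show "recolouring K X \<subseteq> X \<times> X"
    by (auto simp: recolouring_def)
  show "refl_on X (recolouring K X)"
    by (auto simp: recolouring_def refl_on_def intro!: exI[of _ id] permutes_id)
  show "sym (recolouring K X)"
  proof (rule symI, clarify)
    fix S c T d assume "((S, c), (T, d)) \<in> recolouring K X"
    then obtain \<pi> where *: "(S, c) \<in> X" "(T, d) \<in> X" "S = T" "\<pi> permutes K"
      "\<forall>x\<in>S. d x = \<pi> (c x)" by (auto simp: recolouring_def)
    have "inv \<pi> permutes K" "\<forall>x\<in>T. c x = inv \<pi> (d x)"
      using * by (auto simp: permutes_inv permutes_inverses)
    then show "((T, d), (S, c)) \<in> recolouring K X"
      using * by (auto simp: recolouring_def)
  qed
  show "trans (recolouring K X)"
  proof (rule transI, clarify)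
    fix S c T d U e
    assume a: "((S, c), (T, d)) \<in> recolouring K X" "((T, d), (U, e)) \<in> recolouring K X"
    from a(1) obtain \<pi> where 1: "\<pi> permutes K" "\<forall>x\<in>S. d x = \<pi> (c x)"
      by (auto simp: recolouring_def)
    from a(2) obtain \<rho> where 2: "\<rho> permutes K" "\<forall>x\<in>T. e x = \<rho> (d x)"
      by (auto simp: recolouring_def)
    have "(\<rho> \<circ> \<pi>) permutes K" "\<forall>x\<in>S. e x = (\<rho> \<circ> \<pi>) (c x)"
      using 1 2 a by (auto simp: permutes_compose recolouring_def)
    then show "((S, c), (U, e)) \<in> recolouring K X"
      using a unfolding recolouring_def by blast
  qed
qed

definition tree_poset :: "nat \<Rightarrow> nat list rel" where
  "tree_poset n = {(q, p). q \<in> lists {..<n} \<and> p \<in> lists {..<n} \<and> prefix p q}"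

lemma Field_tree_poset: "Field (tree_poset n) = lists {..<n}"
  by (auto simp: Field_def tree_poset_def)

lemma Partial_order_tree_poset: "Partial_order (tree_poset n)"
  unfolding partial_order_on_def preorder_on_def Field_tree_poset
  by (auto simp: tree_poset_def refl_on_def trans_def antisym_def)

lemma tree_poset_root: "p \<in> lists {..<n} \<Longrightarrow> (p, []) \<in> tree_poset n"
  by (simp add: tree_poset_def)

lemma covers_tree_poset:
  "covers (tree_poset n) p q \<longleftrightarrow> p \<in> lists {..<n} \<and> (\<exists>a<n. q = p @ [a])"
proof
  assume c: "covers (tree_poset n) p q"
  then have p: "p \<in> lists {..<n}" and q: "q \<in> lists {..<n}" and pq: "prefix p q" "q \<noteq> p"
    by (auto simp: covers_def tree_poset_def)
  from pq obtain a xs where q_eq: "q = p @ a # xs"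
    by (metis append_Nil2 neq_Nil_conv prefix_def)
  have "xs = []"
  proof (rule ccontr)
    assume "xs \<noteq> []"
    then have "(q, p @ [a]) \<in> tree_poset n \<and> q \<noteq> p @ [a] \<and> (p @ [a], p) \<in> tree_poset n \<and> p @ [a] \<noteq> p"
      using p q q_eq by (auto simp: tree_poset_def)
    with c show False unfolding covers_def by blast
  qed
  with p q q_eq show "p \<in> lists {..<n} \<and> (\<exists>a<n. q = p @ [a])" by auto
next
  assume "p \<in> lists {..<n} \<and> (\<exists>a<n. q = p @ [a])"
  then show "covers (tree_poset n) p q"
    by (auto simp: covers_def tree_poset_def)
qed

(* The root of the tree is the empty word. *)
definition lower_DSCs :: "nat \<Rightarrow> nat \<Rightarrow> (nat list set \<times> (nat list \<Rightarrow> nat)) set" where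
  "lower_DSCs n k = {(S, c). DSC (tree_poset n) {..<k} S c \<and> S \<noteq> {[]}}"

definition num_lower_DSCs :: "nat \<Rightarrow> nat \<Rightarrow> nat" where
  "num_lower_DSCs n k = card (lower_DSCs n k // recolouring {..<k} (lower_DSCs n k))"

lemma DSC_tree_length:
  assumes n: "n \<ge> 2" and D: "DSC (tree_poset n) {..<k} S c" and w: "w \<in> S"
  shows "length w \<le> k * n"
proof -
  let ?r = "tree_poset n"
  have fibre: "finite {p \<in> S. c p = i} \<and> card {p \<in> S. c p = i} \<le> n" for i
  proof (cases "\<exists>p\<in>S. \<exists>q\<in>S. p \<noteq> q \<and> c p = i \<and> c q = i")
    case True
    then obtain p q where pq: "p \<in> S" "q \<in> S" "p \<noteq> q" "c p = i" "c q = i" by blast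
    have sib: "siblings ?r p x" if "x \<in> S" "c x = i" "x \<noteq> p" for x
      using D that pq unfolding DSC_def by metis
    from sib[OF pq(2) pq(5)] pq(3) obtain s a where s: "p = s @ [a]" "a < n"
      by (auto simp: siblings_def covers_tree_poset)
    have "{p \<in> S. c p = i} \<subseteq> (\<lambda>a. s @ [a]) ` {..<n}"
      using s sib by (fastforce simp: siblings_def covers_tree_poset)
    then have "finite {p \<in> S. c p = i}" "card {p \<in> S. c p = i} \<le> card ((\<lambda>a. s @ [a]) ` {..<n})"
      by (auto intro: finite_subset card_mono)
    moreover have "card ((\<lambda>a. s @ [a]) ` {..<n}) \<le> n"
      using card_image_le[of "{..<n}" "\<lambda>a. s @ [a]"] by simp
    ultimately show ?thesis by linarith
  next
    case False
    have "{p \<in> S. c p = i} = {} \<or> (\<exists>p. {p \<in> S. c p = i} = {p})"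
    proof (cases "\<exists>p\<in>S. c p = i")
      case True
      then obtain p where "p \<in> S" "c p = i" by blast
      with False have "{p \<in> S. c p = i} = {p}" by blast
      then show ?thesis by blast
    qed blast
    moreover have "finite A \<and> card A \<le> n" if "A = {} \<or> (\<exists>p. A = {p})" for A :: "nat list set"
      using that n by auto
    ultimately show ?thesis by blast
  qed
  have S_eq: "S = (\<Union>i<k. {p \<in> S. c p = i})" 
  proof -
    have "c ` S = {..<k}" using D by (simp add: DSC_def)
    then have "c p < k" if "p \<in> S" for p using that by blast
    then show ?thesis by blast
  qed
  have "finite (\<Union>i<k. {p \<in> S. c p = i})" using fibre by (intro finite_UN_I) auto
  with S_eq have fin: "finite S" by simp
  have "card S \<le> (\<Sum>i<k. card {p \<in> S. c p = i})"
    using card_UN_le[of "{..<k}" "\<lambda>i. {p \<in> S. c p = i}"] S_eq by simp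
  also have "\<dots> \<le> (\<Sum>i<k. n)" using fibre by (intro sum_mono) auto
  finally have cardS: "card S \<le> k * n" by simp
  have SF: "S \<subseteq> lists {..<n}"
    using D unfolding DSC_def maximal_antichain_def antichain_def Field_tree_poset by blast
  have anti: "\<not> prefix p q" if "p \<in> S" "q \<in> S" "p \<noteq> q" for p q
  proof -
    have "\<not> comparable ?r p q"
      using D that unfolding DSC_def maximal_antichain_def antichain_def by blast
    moreover have "p \<in> lists {..<n}" "q \<in> lists {..<n}" using that SF by blast+
    ultimately show ?thesis by (simp add: comparable_def tree_poset_def)
  qed
  have "\<exists>s\<in>S. length s > i \<and> take i s = take i w \<and> s ! i \<noteq> w ! i" if i: "i < length w" for i
  proof -
    define a where "a = (if w ! i = 0 then 1 else 0 :: nat)"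
    have a: "a < n" "a \<noteq> w ! i" using n by (auto simp: a_def)
    let ?v = "take i w @ [a]"
    have wl: "w \<in> lists {..<n}" using w SF by blast
    then have v: "?v \<in> lists {..<n}" using a by (auto dest: in_set_takeD)
    have "\<exists>s\<in>S. comparable ?r ?v s"
    proof (cases "?v \<in> S")
      case True
      moreover have "comparable ?r ?v ?v"
        using v by (simp add: comparable_def tree_poset_def del: append_in_lists_conv)
      ultimately show ?thesis by blast
    next
      case False
      then show ?thesis using D v
        unfolding DSC_def maximal_antichain_def Field_tree_poset by blast
    qed
    then obtain s where s: "s \<in> S" "prefix ?v s \<or> prefix s ?v"
      by (auto simp: comparable_def tree_poset_def)
    have "prefix ?v s"
    proof (rule ccontr)
      assume "\<not> prefix ?v s"
      with s have "prefix s (take i w)" by (auto simp: prefix_snoc)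
      then have "prefix s w" "s \<noteq> w"
        using i by (auto intro: prefix_order.trans take_is_prefix dest: prefix_length_le)
      with anti s w show False by blast
    qed
    then obtain t where "s = ?v @ t" by (auto simp: prefix_def)
    then have "length s > i \<and> take i s = take i w \<and> s ! i \<noteq> w ! i"
      using i a by (auto simp: nth_append)
    with s show ?thesis by blast
  qed
  then obtain s where s: "\<And>i. i < length w \<Longrightarrow>
      s i \<in> S \<and> length (s i) > i \<and> take i (s i) = take i w \<and> s i ! i \<noteq> w ! i" by metis
  have "s i \<noteq> s j" if "i < j" "j < length w" for i j
    using s[of i] s[of j] that by (metis nth_take order_less_trans)
  then have "inj_on s {..<length w}"
    by (intro inj_onI) (metis lessThan_iff linorder_neqE_nat)
  then have "length w \<le> card S"
    using card_inj_on_le[of s "{..<length w}" S] s fin by auto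
  with cardS show ?thesis by simp
qed

(* For n \<ge> 2 only finitely many DSCs are counted, so the cardinality above is a genuine count. *)
lemma finite_lower_DSCs:
  assumes "n \<ge> 2"
  shows "finite (lower_DSCs n k)"
    and "finite (lower_DSCs n k // recolouring {..<k} (lower_DSCs n k))"
proof -
  let ?W = "{w. set w \<subseteq> {..<n} \<and> length w \<le> k * n}"
  have W: "finite ?W" by (rule finite_lists_length_le) simp
  have "lower_DSCs n k \<subseteq> (SIGMA S : Pow ?W. S \<rightarrow>\<^sub>E {..<k})"
  proof (rule subrelI, rule SigmaI, rule PowI, rule subsetI)
    fix S c w assume X: "(S, c) \<in> lower_DSCs n k"
    then have D: "DSC (tree_poset n) {..<k} S c" by (simp add: lower_DSCs_def)
    then show "c \<in> S \<rightarrow>\<^sub>E {..<k}" by (simp add: DSC_def)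
    assume w: "w \<in> S"
    with D have "w \<in> lists {..<n}"
      unfolding DSC_def maximal_antichain_def antichain_def Field_tree_poset by blast
    then show "w \<in> ?W" using DSC_tree_length[OF assms D w] by auto
  qed
  moreover have "finite (SIGMA S : Pow ?W. S \<rightarrow>\<^sub>E {..<k})"
    using W by (intro finite_SigmaI finite_PiE) (auto intro: finite_subset)
  ultimately show f: "finite (lower_DSCs n k)" by (rule finite_subset)
  show "finite (lower_DSCs n k // recolouring {..<k} (lower_DSCs n k))"
    by (rule finite_quotient[OF f]) (auto simp: recolouring_def)
qed

definition lower_DSC_gf :: "nat \<Rightarrow> int fps" where
  "lower_DSC_gf n = Abs_fps (\<lambda>k. int (num_lower_DSCs n k))"

definition touchard :: "nat \<Rightarrow> int poly" where
  "touchard u = (\<Sum>k\<le>u. monom (int (Stirling u k)) k)"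

end

theory Submission
  imports Defs "HOL-Library.Disjoint_Sets"
begin

text \<open>
  Up to recolouring, a lower DSC is a partition \<open>P\<close> of a maximal antichain \<open>S\<close> not containing the
  root into blocks of siblings. Let \<open>U\<close> be the set of children of the root that lie in \<open>S\<close>. Siblings
  either are all children of the root or lie below a common child, so \<open>P\<close> consists of an arbitrary
  partition of \<open>U\<close> together with, for each child outside \<open>U\<close>, a lower DSC of the subtree below it,
  which is a copy of the whole tree. Partitions of \<open>U\<close> have generating function
  \<open>touchard (card U)\<close>, and summing over all \<open>U\<close> gives the functional equation.
\<close>

unbundle fps_syntax

section \<open>Generating functions of weighted sets\<close>

definition ogf :: "'a set \<Rightarrow> ('a \<Rightarrow> nat) \<Rightarrow> int fps" where
  "ogf A w = Abs_fps (\<lambda>k. int (card {x \<in> A. w x = k}))"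

text \<open>\<open>card\<close> of an infinite set is 0, so the product and sum rules for
  \<open>ogf\<close> are only correct when every fibre is finite.\<close>

definition finite_fibres :: "'a set \<Rightarrow> ('a \<Rightarrow> nat) \<Rightarrow> bool" where
  "finite_fibres A w \<longleftrightarrow> (\<forall>k. finite {x \<in> A. w x = k})"

lemma ogf_nth [simp]: "ogf A w $ k = int (card {x \<in> A. w x = k})"
  by (simp add: ogf_def)

lemma bij_betw_fibre:
  assumes "bij_betw h A B" and "\<And>x. x \<in> A \<Longrightarrow> v (h x) = w x"
  shows "bij_betw h {x \<in> A. w x = k} {y \<in> B. v y = k}"
  using assms unfolding bij_betw_def by (auto intro: inj_on_subset)

lemma ogf_bij:
  assumes "bij_betw h A B" and "\<And>x. x \<in> A \<Longrightarrow> v (h x) = w x"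
  shows "ogf A w = ogf B v"
  by (intro fps_ext) (simp add: bij_betw_same_card[OF bij_betw_fibre[of h A B v w, OF assms]])

lemma finite_fibres_bij:
  assumes "bij_betw h A B" and "\<And>x. x \<in> A \<Longrightarrow> v (h x) = w x" and "finite_fibres A w"
  shows "finite_fibres B v"
  using assms(3) bij_betw_finite[OF bij_betw_fibre[of h A B v w, OF assms(1,2)]]
  by (simp add: finite_fibres_def)

lemma fibre_times:
  fixes w :: "'a \<Rightarrow> nat" and v :: "'b \<Rightarrow> nat"
  shows "{z \<in> A \<times> B. (case z of (x, y) \<Rightarrow> w x + v y) = k} =
    (\<Union>i\<le>k. {x \<in> A. w x = i} \<times> {y \<in> B. v y = k - i})"
  by auto

lemma finite_fibres_times:
  assumes "finite_fibres A w" and "finite_fibres B v"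
  shows "finite_fibres (A \<times> B) (\<lambda>(x, y). w x + v y)"
  using assms unfolding finite_fibres_def fibre_times by blast

text \<open>The fibre over \<open>k\<close> is the disjoint union over \<open>i\<close> of the
  products of the fibres over \<open>i\<close> and \<open>k - i\<close>, which is the Cauchy product
  on coefficients.\<close>

lemma ogf_times:
  assumes "finite_fibres A w" and "finite_fibres B v"
  shows "ogf (A \<times> B) (\<lambda>(x, y). w x + v y) = ogf A w * ogf B v"
proof (rule fps_ext)
  fix k
  have "card {z \<in> A \<times> B. (case z of (x, y) \<Rightarrow> w x + v y) = k} =
      (\<Sum>i\<le>k. card ({x \<in> A. w x = i} \<times> {y \<in> B. v y = k - i}))"
    unfolding fibre_times
    by (rule card_UN_disjoint) (use assms in \<open>auto simp: finite_fibres_def\<close>)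
  then show "ogf (A \<times> B) (\<lambda>(x, y). w x + v y) $ k = (ogf A w * ogf B v) $ k"
    by (simp add: fps_mult_nth card_cartesian_product atMost_atLeast0)
qed

lemma ogf_singleton: "ogf {x} (\<lambda>_. 0) = 1"
  by (rule fps_ext) simp

text \<open>Induction on \<open>I\<close>, splitting off one coordinate by function update.
  Finiteness of the fibres is carried along because \<open>ogf_times\<close> asks for it in each
  step.\<close>

lemma ogf_PiE:
  assumes "finite I" and "finite_fibres A w"
  shows "finite_fibres (I \<rightarrow>\<^sub>E A) (\<lambda>g. \<Sum>i\<in>I. w (g i)) \<and>
    ogf (I \<rightarrow>\<^sub>E A) (\<lambda>g. \<Sum>i\<in>I. w (g i)) = ogf A w ^ card I"
  using assms(1)
proof induction
  case empty
  show ?case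
    by (simp add: finite_fibres_def ogf_singleton)
next
  case (insert i I)
  let ?h = "\<lambda>(y, g). g(i := y)"
  have bij: "bij_betw ?h (A \<times> (I \<rightarrow>\<^sub>E A)) (insert i I \<rightarrow>\<^sub>E A)"
    unfolding bij_betw_def
  proof
    show "inj_on ?h (A \<times> (I \<rightarrow>\<^sub>E A))"
      using inj_combinator[of i I "\<lambda>_. A"] insert.hyps by simp
  qed (simp add: PiE_insert_eq)
  have wt: "(\<Sum>j\<in>insert i I. w (?h z j)) = (case z of (y, g) \<Rightarrow> w y + (\<Sum>j\<in>I. w (g j)))"
    if "z \<in> A \<times> (I \<rightarrow>\<^sub>E A)" for z
    using insert.hyps by (cases z) (auto intro!: sum.cong)
  have *: "finite_fibres (A \<times> (I \<rightarrow>\<^sub>E A)) (\<lambda>(y, g). w y + (\<Sum>j\<in>I. w (g j)))"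
    "ogf (A \<times> (I \<rightarrow>\<^sub>E A)) (\<lambda>(y, g). w y + (\<Sum>j\<in>I. w (g j))) = ogf A w * ogf A w ^ card I"
    using insert.IH assms(2) by (simp_all add: finite_fibres_times ogf_times)
  show ?case
    using finite_fibres_bij[where v = "\<lambda>g. \<Sum>j\<in>insert i I. w (g j)", OF bij wt *(1)]
      ogf_bij[where v = "\<lambda>g. \<Sum>j\<in>insert i I. w (g j)", OF bij wt] *(2) insert.hyps by simp
qed

text \<open>Tagged disjoint unions add up. The weight may vary with the index, because the set of
  subtrees that contribute blocks will depend on \<open>U\<close>.\<close>

lemma ogf_Sigma:
  assumes "finite I" and "\<And>i. i \<in> I \<Longrightarrow> finite_fibres (A i) (w i)"
  shows "ogf (Sigma I A) (\<lambda>(i, x). w i x) = (\<Sum>i\<in>I. ogf (A i) (w i))"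
proof (rule fps_ext)
  fix k
  have "{z \<in> Sigma I A. (case z of (i, x) \<Rightarrow> w i x) = k} = (SIGMA i:I. {x \<in> A i. w i x = k})"
    by auto
  moreover have "card \<dots> = (\<Sum>i\<in>I. card {x \<in> A i. w i x = k})"
    using assms by (intro card_SigmaI) (auto simp: finite_fibres_def)
  ultimately show "ogf (Sigma I A) (\<lambda>(i, x). w i x) $ k = (\<Sum>i\<in>I. ogf (A i) (w i)) $ k"
    by (simp add: fps_sum_nth)
qed

text \<open>Grouping the subsets by size produces the binomial coefficients of the functional
  equation.\<close>

lemma sum_Pow_card:
  fixes h :: "nat \<Rightarrow> 'b::comm_semiring_1"
  assumes "finite A"
  shows "(\<Sum>U\<in>Pow A. h (card U)) = (\<Sum>u\<le>card A. of_nat (card A choose u) * h u)"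
proof -
  have "(\<Sum>U\<in>Pow A. h (card U)) = (\<Sum>u\<le>card A. \<Sum>U | U \<in> Pow A \<and> card U = u. h (card U))"
    using assms by (intro sum.group[symmetric]) (auto intro: card_mono)
  also have "\<dots> = (\<Sum>u\<le>card A. of_nat (card A choose u) * h u)"
  proof (rule sum.cong[OF refl])
    fix u
    have "(\<Sum>U | U \<in> Pow A \<and> card U = u. h (card U)) = (\<Sum>U | U \<subseteq> A \<and> card U = u. h u)"
      by (rule sum.cong) auto
    then show "(\<Sum>U | U \<in> Pow A \<and> card U = u. h (card U)) = of_nat (card A choose u) * h u"
      by (simp add: n_subsets[OF assms])
  qed
  finally show ?thesis .
qed

section \<open>Counting set partitions\<close>

lemma partition_on_remove_block:
  assumes "partition_on A P" and "C \<in> P"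
  shows "disjnt C (\<Union>(P - {C}))" and "partition_on (A - C) (P - {C})"
proof -
  show *: "disjnt C (\<Union>(P - {C}))"
    using partition_onD2[OF assms(1)] assms(2) by (auto simp: disjoint_def disjnt_def)
  have "insert C (P - {C}) = P" using assms(2) by auto
  with partition_on_insert[OF *, of A] assms(1) show "partition_on (A - C) (P - {C})" by simp
qed

lemma partition_on_insert_singleton:
  assumes "a \<notin> A" and "partition_on A Q"
  shows "partition_on (insert a A) (insert {a} Q)"
  using assms by (auto simp: partition_on_def disjoint_def)

lemma partition_on_insert_into_block:
  assumes "a \<notin> A" and "partition_on A Q" and "B \<in> Q"
  shows "partition_on (insert a A) (insert (insert a B) (Q - {B}))"
proof -
  note rest = partition_on_remove_block[OF assms(2,3)]
  have "a \<notin> \<Union>Q" "B \<subseteq> A"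
    using assms by (auto simp: partition_on_def)
  then have "disjnt (insert a B) (\<Union>(Q - {B}))" "insert a A - insert a B = A - B"
    "insert a B \<subseteq> insert a A"
    using rest(1) assms(1) by (auto simp: disjnt_def)
  then show ?thesis
    using rest(2) by (subst partition_on_insert) auto
qed

text \<open>The block \<open>C\<close> containing \<open>a\<close> either is \<open>{a}\<close>, or
  stays nonempty once \<open>a\<close> is deleted and is then a block \<open>B\<close> of a
  partition of \<open>A\<close>.\<close>

lemma partition_on_insert_cases:
  assumes "a \<notin> A" and "partition_on (insert a A) P"
  obtains Q where "partition_on A Q" and "P = insert {a} Q"
  | Q B where "partition_on A Q" and "B \<in> Q" and "P = insert (insert a B) (Q - {B})"
proof -
  obtain C where C: "C \<in> P" "a \<in> C"
    using assms by (auto simp: partition_on_def)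
  note rest = partition_on_remove_block[OF assms(2) C(1)]
  show thesis
  proof (cases "C = {a}")
    case True
    have "partition_on A (P - {C})"
      using rest(2) True assms(1) by simp
    with that(1)[of "P - {C}"] True C show thesis by auto
  next
    case False
    have "disjnt (C - {a}) (\<Union>(P - {C}))"
      using rest(1) by (auto simp: disjnt_def)
    moreover have "C \<subseteq> insert a A" "C - {a} \<noteq> {}" "A - (C - {a}) = insert a A - C"
      using False C assms by (auto simp: partition_on_def)
    ultimately have "partition_on A (insert (C - {a}) (P - {C}))"
      using rest(2) by (subst partition_on_insert) auto
    \<comment> \<open>Needed so that inserting \<open>C - {a}\<close> and removing it again gives
      back exactly \<open>P - {C}\<close>.\<close>
    moreover have "C - {a} \<notin> P - {C}"
    proof
      assume "C - {a} \<in> P - {C}"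
      with rest(1) have "C - {a} = {}"
        by (auto simp: disjnt_def)
      with False C show False by blast
    qed
    moreover have "P = insert (insert a (C - {a})) (insert (C - {a}) (P - {C}) - {C - {a}})"
      using C calculation(2) by (simp add: insert_absorb)
    ultimately show thesis using that(2)[of "insert (C - {a}) (P - {C})" "C - {a}"] by blast
  qed
qed

text \<open>The recurrence of the Stirling numbers: the new point forms its own block, or joins one
  of the \<open>Suc k\<close> blocks of a partition of \<open>A\<close>.\<close>

lemma card_partition_on_Suc:
  assumes "finite A" and "a \<notin> A"
  shows "card {P. partition_on (insert a A) P \<and> card P = Suc k} =
    Suc k * card {Q. partition_on A Q \<and> card Q = Suc k} + card {Q. partition_on A Q \<and> card Q = k}"
proof -
  let ?N = "{Q. partition_on A Q \<and> card Q = k}"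
  \<comment> \<open>Pairs of a partition and the block chosen to receive \<open>a\<close>; each
    partition contributes \<open>Suc k\<close> of them.\<close>
  let ?M = "SIGMA Q:{Q. partition_on A Q \<and> card Q = Suc k}. Q"
  let ?m = "\<lambda>(Q, B). insert (insert a B) (Q - {B})"
  have fin: "finite Q" if "partition_on A Q" for Q
    using finite_elements[OF assms(1) that] .
  have a_notin: "a \<notin> B" if "partition_on A Q" "B \<in> Q" for Q B
    using that assms(2) by (auto simp: partition_on_def)
  have card_n: "card (insert {a} Q) = Suc (card Q)" if "partition_on A Q" for Q
    using a_notin[OF that, of "{a}"] fin[OF that] by (subst card_insert_disjoint) auto
  have card_m: "card (insert (insert a B) (Q - {B})) = card Q" if "partition_on A Q" "B \<in> Q" for Q B
  proof -
    \<comment> \<open>The enlarged block is new because no block of \<open>Q\<close> contains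
      \<open>a\<close>, so exchanging \<open>B\<close> for it keeps the number of blocks.\<close>
    have "insert a B \<notin> Q" using a_notin[OF that(1), of "insert a B"] by auto
    with fin[OF that(1)] that(2) show ?thesis
      by (metis DiffD1 card_Suc_Diff1 card_insert_disjoint finite_Diff)
  qed
  have "{P. partition_on (insert a A) P \<and> card P = Suc k} = insert {a} ` ?N \<union> ?m ` ?M"
  proof (intro equalityI subsetI)
    fix P assume "P \<in> {P. partition_on (insert a A) P \<and> card P = Suc k}"
    then have P: "partition_on (insert a A) P" "card P = Suc k" by auto
    from assms(2) P(1) show "P \<in> insert {a} ` ?N \<union> ?m ` ?M"
    proof (cases rule: partition_on_insert_cases)
      case (1 Q)
      with P card_n have "Q \<in> ?N" by auto
      with 1 show ?thesis by blast
    next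
      case (2 Q B)
      with P card_m have "(Q, B) \<in> ?M" by auto
      with 2 show ?thesis by force
    qed
  next
    fix P assume "P \<in> insert {a} ` ?N \<union> ?m ` ?M"
    then show "P \<in> {P. partition_on (insert a A) P \<and> card P = Suc k}"
      using partition_on_insert_singleton[OF assms(2)] partition_on_insert_into_block[OF assms(2)]
        card_n card_m by auto
  qed
  moreover have "insert {a} ` ?N \<inter> ?m ` ?M = {}"
  proof -
    \<comment> \<open>The two constructions never agree: the singleton block \<open>{a}\<close>
      could only arise from an empty \<open>B\<close>.\<close>
    have "insert {a} Q \<noteq> ?m (R, B)" if "partition_on A Q" "partition_on A R" "B \<in> R" for Q R B
    proof
      assume eq: "insert {a} Q = ?m (R, B)"
      then have "{a} = insert a B \<or> {a} \<in> R" by auto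
      then have "B = {}"
        using a_notin[OF that(2,3)] a_notin[OF that(2), of "{a}"] by auto
      then show False
        using that(2,3) by (auto simp: partition_on_def)
    qed
    then show ?thesis by fastforce
  qed
  moreover have "inj_on (insert {a}) ?N"
  proof (rule inj_onI)
    fix Q R assume "Q \<in> ?N" "R \<in> ?N" "insert {a} Q = insert {a} R"
    moreover have "{a} \<notin> Q" "{a} \<notin> R" using calculation a_notin by blast+
    ultimately show "Q = R" by (simp add: insert_ident)
  qed
  moreover have "inj_on ?m ?M"
  proof (rule inj_onI, clarify)
    fix Q B R C
    assume Q: "partition_on A Q" "B \<in> Q" and R: "partition_on A R" "C \<in> R"
      and eq: "insert (insert a B) (Q - {B}) = insert (insert a C) (R - {C})"
    have "insert a B \<in> insert (insert a C) (R - {C})" using eq by blast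
    moreover have "insert a B \<notin> R" using a_notin[OF R(1), of "insert a B"] by blast
    ultimately have "insert a B = insert a C" by blast
    then have "B = C" by (rule insert_ident[OF a_notin[OF Q] a_notin[OF R], THEN iffD1])
    moreover have "Q - {B} = R - {C}"
    proof -
      \<comment> \<open>The untouched blocks are recognised in the enlarged partition as those
        avoiding \<open>a\<close>.\<close>
      have "Q - {B} = {D \<in> insert (insert a B) (Q - {B}). a \<notin> D}"
        using a_notin[OF Q(1)] by auto
      also have "\<dots> = {D \<in> insert (insert a C) (R - {C}). a \<notin> D}" using eq by simp
      also have "\<dots> = R - {C}" using a_notin[OF R(1)] by auto
      finally show ?thesis .
    qed
    ultimately show "Q = R \<and> B = C" using Q R by auto
  qed
  moreover have "finite ?N" and fin': "finite {Q. partition_on A Q \<and> card Q = Suc k}"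
    using finitely_many_partition_on[OF assms(1)] by (auto intro: rev_finite_subset)
  moreover have "finite ?M"
    using fin fin' by (intro finite_SigmaI) auto
  moreover have "card ?M = Suc k * card {Q. partition_on A Q \<and> card Q = Suc k}"
    using fin fin' by (subst card_SigmaI) auto
  ultimately show ?thesis
    by (simp only: card_Un_disjoint card_image finite_imageI add.commute)
qed

lemma card_partition_on:
  assumes "finite A"
  shows "card {P. partition_on A P \<and> card P = k} = Stirling (card A) k"
  using assms
proof (induction arbitrary: k)
  case empty
  have "{P. P = {} \<and> card P = k} = (if k = 0 then {{}} else {} :: 'a set set set)" by auto
  then show ?case by (cases k) (simp_all add: partition_on_empty)
next
  case (insert a A)
  show ?case
  proof (cases k)
    case 0
    \<comment> \<open>A nonempty set needs at least one block; \<open>finite P\<close> rules out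
      that \<open>card P\<close> is 0 merely because \<open>P\<close> is infinite.\<close>
    have "{P. partition_on (insert a A) P \<and> card P = 0} = {}"
    proof -
      have "card P \<noteq> 0" if "partition_on (insert a A) P" for P
      proof -
        have "finite P" using finite_elements[OF _ that] insert.hyps by simp
        moreover have "P \<noteq> {}" using that by (auto simp: partition_on_def)
        ultimately show ?thesis by simp
      qed
      then show ?thesis by blast
    qed
    then have "card {P. partition_on (insert a A) P \<and> card P = 0} = 0" by (simp only: card.empty)
    with 0 insert.hyps show ?thesis by (metis Stirling.simps(3) card_insert_disjoint)
  next
    case (Suc j)
    show ?thesis
      unfolding Suc card_partition_on_Suc[OF insert.hyps]
      by (simp add: insert.IH insert.hyps)
  qed
qed

lemma ogf_partition_on:
  assumes "finite A"
  shows "ogf {P. partition_on A P} card = fps_of_poly (touchard (card A))"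
proof (rule fps_ext)
  fix k
  \<comment> \<open>Beyond degree \<open>u\<close> the coefficient is 0, in agreement with the
    vanishing Stirling numbers.\<close>
  have "coeff (touchard u) k = int (Stirling u k)" for u
    by (cases "k \<le> u") (auto simp: touchard_def coeff_sum coeff_monom)
  then show "ogf {P. partition_on A P} card $ k = fps_of_poly (touchard (card A)) $ k"
    using card_partition_on[OF assms, of k] by simp
qed

section \<open>Decorated sweep covers as partitions\<close>

text \<open>If \<open>f\<close> is a complete invariant for \<open>r\<close>, the classes are the
  fibres of \<open>f\<close> and correspond to its values.\<close>

lemma card_quotient_eq_card_image:
  assumes "r \<subseteq> X \<times> X" and "\<And>x y. x \<in> X \<Longrightarrow> y \<in> X \<Longrightarrow> (x, y) \<in> r \<longleftrightarrow> f x = f y"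
  shows "card (X // r) = card (f ` X)"
proof -
  let ?fib = "\<lambda>z. {y \<in> X. f y = z}"
  have "r `` {x} = ?fib (f x)" if "x \<in> X" for x
    using that assms by auto
  then have "X // r = ?fib ` f ` X"
    by (force simp: quotient_def)
  moreover have "inj_on ?fib (f ` X)"
    by (rule inj_onI) blast
  ultimately show ?thesis
    by (simp add: card_image)
qed

text \<open>Indexed by the points of \<open>S\<close> rather than by colours, so that no empty class
  occurs.\<close>

definition colour_classes :: "'a set \<Rightarrow> ('a \<Rightarrow> 'c) \<Rightarrow> 'a set set" where
  "colour_classes S c = (\<lambda>x. {y \<in> S. c y = c x}) ` S"

lemma partition_on_colour_classes: "partition_on S (colour_classes S c)"
  unfolding colour_classes_def by (rule partition_onI) (auto simp: disjnt_def)

lemma Union_colour_classes [simp]: "\<Union>(colour_classes S c) = S"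
  using partition_onD1[OF partition_on_colour_classes] by metis

lemma bij_betw_colour_classes:
  "bij_betw (\<lambda>i. {y \<in> S. c y = i}) (c ` S) (colour_classes S c)"
  unfolding bij_betw_def colour_classes_def by (auto simp: inj_on_def)

lemma colour_classes_eqD:
  assumes "colour_classes S c = colour_classes S d" and "x \<in> S" and "y \<in> S"
  shows "c x = c y \<longleftrightarrow> d x = d y"
proof -
  have "{z \<in> S. c z = c x} \<in> colour_classes S d"
    using assms(1,2) by (auto simp: colour_classes_def)
  then obtain u where "{z \<in> S. c z = c x} = {z \<in> S. d z = d u}"
    by (auto simp: colour_classes_def)
  with assms(2,3) show ?thesis
    by (metis (mono_tags, lifting) mem_Collect_eq)
qed

text \<open>A permutation of colours is injective and so preserves which points share a colour.
  Conversely, colourings with equal classes differ by a bijection between the colours they use,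
  which here are all of \<open>K\<close>.\<close>

lemma recolouring_iff_colour_classes:
  assumes "(S, c) \<in> X" and "(T, d) \<in> X" and "c ` S = K" and "d ` T = K"
  shows "((S, c), (T, d)) \<in> recolouring K X \<longleftrightarrow> colour_classes S c = colour_classes T d"
proof
  assume "((S, c), (T, d)) \<in> recolouring K X"
  then obtain \<pi> where \<pi>: "S = T" "\<pi> permutes K" "\<forall>x\<in>S. d x = \<pi> (c x)"
    by (auto simp: recolouring_def)
  then have "{y \<in> S. c y = c x} = {y \<in> T. d y = d x}" if "x \<in> S" for x
    using that permutes_inj[OF \<pi>(2)] by (auto dest: injD)
  with \<pi>(1) show "colour_classes S c = colour_classes T d"
    by (auto simp: colour_classes_def)
next
  assume eq: "colour_classes S c = colour_classes T d"
  then have ST: "S = T" by (metis Union_colour_classes)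
  have kernel: "c x = c y \<longleftrightarrow> d x = d y" if "x \<in> S" "y \<in> S" for x y
    using colour_classes_eqD[of S c d] eq ST that by simp
  \<comment> \<open>Send a colour to the \<open>d\<close>-colour of any point carrying it;
    \<open>kernel\<close> makes the choice of the point irrelevant.\<close>
  define \<sigma> where "\<sigma> i = d (SOME x. x \<in> S \<and> c x = i)" for i
  have \<sigma>: "\<sigma> (c x) = d x" if "x \<in> S" for x
  proof -
    have "(SOME y. y \<in> S \<and> c y = c x) \<in> S \<and> c (SOME y. y \<in> S \<and> c y = c x) = c x"
      by (rule someI[of _ x]) (use that in simp)
    with kernel that show ?thesis
      unfolding \<sigma>_def by blast
  qed
  have "bij_betw \<sigma> K K"
    unfolding bij_betw_def
  proof
    show "inj_on \<sigma> K"
      unfolding assms(3)[symmetric] by (rule inj_onI) (auto simp: \<sigma> kernel)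
    have "\<sigma> ` c ` S = d ` S"
      using \<sigma> by (simp add: image_image)
    with assms(3,4) ST show "\<sigma> ` K = K" by simp
  qed
  \<comment> \<open>\<open>permutes\<close> demands that everything outside \<open>K\<close> is
    fixed, hence the extension by the identity.\<close>
  then have "bij_betw (\<lambda>i. if i \<in> K then \<sigma> i else i) K K"
    by (subst bij_betw_cong[of K _ \<sigma>]) auto
  then have "(\<lambda>i. if i \<in> K then \<sigma> i else i) permutes K"
    by (rule bij_imp_permutes) simp
  moreover have "\<forall>x\<in>S. d x = (if c x \<in> K then \<sigma> (c x) else c x)"
    using \<sigma> assms(3) by auto
  ultimately show "((S, c), (T, d)) \<in> recolouring K X"
    using assms(1,2) ST unfolding recolouring_def by blast
qed

text \<open>Label the blocks by \<open>h\<close> and give each point the label of its block;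
  injectivity of \<open>h\<close> keeps distinct blocks apart.\<close>

lemma partition_on_eq_colour_classes:
  assumes "partition_on S P" and "bij_betw h P K"
  obtains c where "c \<in> S \<rightarrow>\<^sub>E K" and "c ` S = K" and "colour_classes S c = P"
proof -
  define c where "c = (\<lambda>x\<in>S. h (THE B. B \<in> P \<and> x \<in> B))"
  have c: "c x = h B" if "B \<in> P" "x \<in> B" for x B
  proof -
    have "(THE B. B \<in> P \<and> x \<in> B) = B"
      using partition_onD2[OF assms(1)] that
      by (intro the_equality) (auto simp: disjoint_def)
    moreover have "x \<in> S"
      using partition_onD1[OF assms(1)] that by blast
    ultimately show ?thesis by (simp add: c_def)
  qed
  have S: "S = \<Union>P" "\<And>B. B \<in> P \<Longrightarrow> B \<noteq> {}"
    using assms(1) by (auto simp: partition_on_def)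
  have cS: "c ` S = K"
  proof -
    have "c ` S = h ` P"
    proof (intro equalityI subsetI)
      fix i assume "i \<in> c ` S" then show "i \<in> h ` P" using S(1) c by auto
    next
      fix i assume "i \<in> h ` P"
      then obtain B where "B \<in> P" "i = h B" by blast
      moreover obtain x where "x \<in> B" using S(2) calculation by blast
      ultimately show "i \<in> c ` S" using S(1) c by (metis UnionI imageI)
    qed
    then show ?thesis using assms(2) by (simp add: bij_betw_def)
  qed
  have cls: "{y \<in> S. c y = c x} = B" if "B \<in> P" "x \<in> B" for x B
  proof -
    have "y \<in> B \<longleftrightarrow> c y = c x" if "y \<in> D" "D \<in> P" for y D
    proof -
      have "c y = c x \<longleftrightarrow> h D = h B"
        using c \<open>B \<in> P\<close> \<open>x \<in> B\<close> that by simp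
      also have "\<dots> \<longleftrightarrow> D = B"
        using assms(2) \<open>B \<in> P\<close> that by (auto simp: bij_betw_def inj_on_def)
      also have "\<dots> \<longleftrightarrow> y \<in> B"
        using partition_onD2[OF assms(1)] \<open>B \<in> P\<close> that by (auto simp: disjoint_def)
      finally show ?thesis by blast
    qed
    with S(1) \<open>B \<in> P\<close> show ?thesis by blast
  qed
  have "colour_classes S c = P"
  proof (intro equalityI subsetI)
    fix C assume "C \<in> colour_classes S c"
    then show "C \<in> P" using S(1) cls by (auto simp: colour_classes_def)
  next
    fix B assume B: "B \<in> P"
    then obtain x where "x \<in> B" using S(2) by blast
    with cls[OF B] B S(1) show "B \<in> colour_classes S c"
      unfolding colour_classes_def by blast
  qed
  moreover have "c \<in> S \<rightarrow>\<^sub>E K"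
    using cS by (auto simp: c_def)
  ultimately show thesis using that cS by blast
qed

text \<open>Colour-free lower DSCs for all \<open>k\<close> at once, with \<open>card P\<close> as
  the weight. The antichain is recovered as \<open>\<Union>P\<close>. Finiteness keeps infinite
  partitions, whose \<open>card\<close> is 0, from being counted at \<open>k = 0\<close>.\<close>

definition lower_DSC_partitions :: "nat \<Rightarrow> nat list set set set" where
  "lower_DSC_partitions n = {P. finite P \<and> partition_on (\<Union>P) P \<and>
     maximal_antichain (tree_poset n) (\<Union>P) \<and> \<Union>P \<noteq> {[]} \<and>
     (\<forall>B\<in>P. pairwise (siblings (tree_poset n)) B)}"

lemma colour_classes_lower_DSCs:
  "(\<lambda>(S, c). colour_classes S c) ` lower_DSCs n k = {P \<in> lower_DSC_partitions n. card P = k}"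
proof (intro equalityI subsetI)
  fix P assume "P \<in> (\<lambda>(S, c). colour_classes S c) ` lower_DSCs n k"
  then obtain S c where P: "P = colour_classes S c" and D: "DSC (tree_poset n) {..<k} S c" "S \<noteq> {[]}"
    by (auto simp: lower_DSCs_def)
  have "bij_betw (\<lambda>i. {y \<in> S. c y = i}) {..<k} P"
    using bij_betw_colour_classes[of S c] D P by (simp add: DSC_def)
  then have "finite P" "card P = k"
    using bij_betw_finite bij_betw_same_card by fastforce+
  moreover have "pairwise (siblings (tree_poset n)) B" if "B \<in> P" for B
    using that D by (auto simp: P colour_classes_def pairwise_def DSC_def)
  ultimately show "P \<in> {P \<in> lower_DSC_partitions n. card P = k}"
    using D partition_on_colour_classes[of S c] by (simp add: P lower_DSC_partitions_def DSC_def)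
next
  fix P assume "P \<in> {P \<in> lower_DSC_partitions n. card P = k}"
  then have P: "finite P" "partition_on (\<Union>P) P" "maximal_antichain (tree_poset n) (\<Union>P)"
    "\<Union>P \<noteq> {[]}" "card P = k" and sib: "\<And>B. B \<in> P \<Longrightarrow> pairwise (siblings (tree_poset n)) B"
    by (auto simp: lower_DSC_partitions_def)
  \<comment> \<open>Any numbering of the blocks serves as a colouring.\<close>
  obtain h where "bij_betw h P {..<k}"
    using ex_bij_betw_finite_nat[OF P(1)] P(5) by (auto simp: atLeast0LessThan)
  from partition_on_eq_colour_classes[OF P(2) this]
  obtain c where c: "c \<in> \<Union>P \<rightarrow>\<^sub>E {..<k}" "c ` \<Union>P = {..<k}" "colour_classes (\<Union>P) c = P" .
  have "siblings (tree_poset n) p q" if "p \<in> \<Union>P" "q \<in> \<Union>P" "p \<noteq> q" "c p = c q" for p q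
  proof -
    have "{y \<in> \<Union>P. c y = c q} \<in> P"
      using that c(3) unfolding colour_classes_def by blast
    from sib[OF this] that show ?thesis
      by (simp add: pairwise_def)
  qed
  then have "DSC (tree_poset n) {..<k} (\<Union>P) c"
    using P(3) c(1,2) unfolding DSC_def by blast
  with P(4) have "(\<Union>P, c) \<in> lower_DSCs n k"
    by (simp add: lower_DSCs_def)
  with c(3) show "P \<in> (\<lambda>(S, c). colour_classes S c) ` lower_DSCs n k"
    by force
qed

text \<open>\<open>colour_classes\<close> is a complete invariant for recolouring, so counting
  orbits of colourings becomes counting partitions.\<close>

lemma num_lower_DSCs_eq:
  "num_lower_DSCs n k = card {P \<in> lower_DSC_partitions n. card P = k}"
proof -
  have "card (lower_DSCs n k // recolouring {..<k} (lower_DSCs n k)) =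
    card ((\<lambda>(S, c). colour_classes S c) ` lower_DSCs n k)"
  proof (rule card_quotient_eq_card_image)
    show "recolouring {..<k} (lower_DSCs n k) \<subseteq> lower_DSCs n k \<times> lower_DSCs n k"
      by (auto simp: recolouring_def)
  next
    fix x y assume xy: "x \<in> lower_DSCs n k" "y \<in> lower_DSCs n k"
    obtain S c T d where *: "x = (S, c)" "y = (T, d)" by (metis surj_pair)
    then have "c ` S = {..<k}" "d ` T = {..<k}"
      using xy by (auto simp: lower_DSCs_def DSC_def)
    with recolouring_iff_colour_classes xy
    show "(x, y) \<in> recolouring {..<k} (lower_DSCs n k) \<longleftrightarrow>
      (case x of (S, c) \<Rightarrow> colour_classes S c) = (case y of (S, c) \<Rightarrow> colour_classes S c)"
      unfolding * by fastforce
  qed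
  then show ?thesis
    by (simp only: num_lower_DSCs_def colour_classes_lower_DSCs)
qed

text \<open>Here \<open>n \<ge> 2\<close> is essential: in the unary tree every one-element set is a
  maximal antichain, giving infinitely many partitions with one block.\<close>

lemma finite_fibres_lower_DSC_partitions:
  assumes "n \<ge> 2"
  shows "finite_fibres (lower_DSC_partitions n) card"
  using finite_lower_DSCs(1)[OF assms]
  by (simp add: finite_fibres_def colour_classes_lower_DSCs[symmetric])

section \<open>Decomposition at the root\<close>

text \<open>Every word is comparable to itself, so maximality can be tested on all words instead of
  those outside \<open>S\<close>; by symmetry the antichain condition needs one direction of
  \<open>prefix\<close>.\<close>

lemma maximal_antichain_tree_iff:
  "maximal_antichain (tree_poset n) S \<longleftrightarrow> S \<subseteq> lists {..<n} \<and>
     (\<forall>p\<in>S. \<forall>q\<in>S. prefix p q \<longrightarrow> p = q) \<and>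
     (\<forall>p\<in>lists {..<n}. \<exists>q\<in>S. prefix p q \<or> prefix q p)" (is "?L \<longleftrightarrow> ?R")
proof
  assume L: ?L
  then have S: "S \<subseteq> lists {..<n}"
    by (simp add: maximal_antichain_def antichain_def Field_tree_poset)
  have "\<not> comparable (tree_poset n) p q" if "p \<in> S" "q \<in> S" "p \<noteq> q" for p q
    using that L by (auto simp: maximal_antichain_def antichain_def)
  then have "p = q" if "p \<in> S" "q \<in> S" "prefix p q" for p q
    using that S by (auto simp: comparable_def tree_poset_def)
  moreover have "\<exists>q\<in>S. prefix p q \<or> prefix q p" if "p \<in> lists {..<n}" for p
  proof (cases "p \<in> S")
    case False
    with L that obtain q where "q \<in> S" "comparable (tree_poset n) p q"
      unfolding maximal_antichain_def Field_tree_poset by blast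
    then show ?thesis by (auto simp: comparable_def tree_poset_def)
  qed auto
  ultimately show ?R using S by blast
next
  assume R: ?R
  show ?L
    unfolding maximal_antichain_def antichain_def Field_tree_poset
  proof (intro conjI ballI impI)
    show "S \<subseteq> lists {..<n}" using R by blast
    show "\<not> comparable (tree_poset n) p q" if "p \<in> S" "q \<in> S" "p \<noteq> q" for p q
      using that R by (auto simp: comparable_def tree_poset_def)
    show "\<exists>q\<in>S. comparable (tree_poset n) p q" if p: "p \<in> lists {..<n} - S" for p
    proof -
      obtain q where "q \<in> S" "prefix p q \<or> prefix q p" using R p by blast
      moreover from this R have "q \<in> lists {..<n}" by blast
      ultimately show ?thesis using p unfolding comparable_def tree_poset_def by blast
    qed
  qed
qed

lemma maximal_antichain_tree_root:
  assumes "maximal_antichain (tree_poset n) S"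
  shows "S = {[]} \<longleftrightarrow> [] \<in> S"
proof
  assume "[] \<in> S"
  moreover have "w = []" if "w \<in> S" for w
    using assms that \<open>[] \<in> S\<close> unfolding maximal_antichain_tree_iff
    by (metis Nil_prefix)
  ultimately show "S = {[]}" by blast
qed simp

text \<open>Words with different first letters are incomparable, so the conditions on
  \<open>S\<close> separate into conditions on the slices by first letter. A slice is
  \<open>{[]}\<close> exactly when that child of the root lies in \<open>S\<close>.\<close>

lemma maximal_antichain_tree_Cons_iff:
  assumes "n > 0"
  shows "maximal_antichain (tree_poset n) S \<and> S \<noteq> {[]} \<longleftrightarrow>
    (\<forall>w\<in>S. \<exists>a<n. \<exists>v. w = a # v) \<and> (\<forall>a<n. maximal_antichain (tree_poset n) {v. a # v \<in> S})"
    (is "?L \<longleftrightarrow> ?R")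
proof
  assume L: ?L
  then have S: "S \<subseteq> lists {..<n}" "\<And>p q. p \<in> S \<Longrightarrow> q \<in> S \<Longrightarrow> prefix p q \<Longrightarrow> p = q"
    "\<And>p. p \<in> lists {..<n} \<Longrightarrow> \<exists>q\<in>S. prefix p q \<or> prefix q p"
    by (auto simp: maximal_antichain_tree_iff)
  have root: "[] \<notin> S"
    using L maximal_antichain_tree_root by blast
  have cons: "\<exists>a<n. \<exists>v. w = a # v" if "w \<in> S" for w
    using that root S(1) by (cases w) auto
  moreover have "maximal_antichain (tree_poset n) {v. a # v \<in> S}" if a: "a < n" for a
    unfolding maximal_antichain_tree_iff
  proof (intro conjI ballI impI)
    show "{v. a # v \<in> S} \<subseteq> lists {..<n}" using S(1) by auto
    show "p = q" if "p \<in> {v. a # v \<in> S}" "q \<in> {v. a # v \<in> S}" "prefix p q" for p q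
      using that S(2)[of "a # p" "a # q"] by simp
    show "\<exists>q\<in>{v. a # v \<in> S}. prefix p q \<or> prefix q p" if "p \<in> lists {..<n}" for p
    proof -
      have "a # p \<in> lists {..<n}" using that a by auto
      from S(3)[OF this] obtain q where q: "q \<in> S" "prefix (a # p) q \<or> prefix q (a # p)"
        by blast
      moreover obtain b v where "q = b # v" using cons[OF q(1)] by blast
      ultimately show ?thesis by auto
    qed
  qed
  ultimately show ?R by blast
next
  assume R: ?R
  then have cons: "\<exists>a<n. \<exists>v. w = a # v" if "w \<in> S" for w
    using that by blast
  have C: "{v. a # v \<in> S} \<subseteq> lists {..<n}"
    "\<And>p q. a # p \<in> S \<Longrightarrow> a # q \<in> S \<Longrightarrow> prefix p q \<Longrightarrow> p = q"
    "\<And>p. p \<in> lists {..<n} \<Longrightarrow> \<exists>q. a # q \<in> S \<and> (prefix p q \<or> prefix q p)" if "a < n" for a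
  proof -
    have *: "maximal_antichain (tree_poset n) {v. a # v \<in> S}" using R that by blast
    show "{v. a # v \<in> S} \<subseteq> lists {..<n}"
      "\<And>p q. a # p \<in> S \<Longrightarrow> a # q \<in> S \<Longrightarrow> prefix p q \<Longrightarrow> p = q"
      "\<And>p. p \<in> lists {..<n} \<Longrightarrow> \<exists>q. a # q \<in> S \<and> (prefix p q \<or> prefix q p)"
      using *[unfolded maximal_antichain_tree_iff] by blast+
  qed
  have "maximal_antichain (tree_poset n) S"
    unfolding maximal_antichain_tree_iff
  proof (intro conjI ballI impI subsetI)
    show "w \<in> lists {..<n}" if w: "w \<in> S" for w
    proof -
      obtain a v where "w = a # v" "a < n" using cons[OF w] by blast
      moreover from this have "v \<in> lists {..<n}" using C(1)[of a] w by blast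
      ultimately show ?thesis by simp
    qed
    show "p = q" if pq: "p \<in> S" "q \<in> S" "prefix p q" for p q
    proof -
      obtain a v where p: "p = a # v" "a < n" using cons[OF pq(1)] by blast
      moreover obtain w where "q = a # w"
        using pq(3) p by (auto simp: prefix_def)
      ultimately show ?thesis using C(2)[of a v w] pq by simp
    qed
    show "\<exists>q\<in>S. prefix p q \<or> prefix q p" if "p \<in> lists {..<n}" for p
    proof (cases p)
      case Nil
      \<comment> \<open>The root needs an element of \<open>S\<close> below it; the slice of the
        letter 0 supplies one, which is where \<open>n > 0\<close> enters.\<close>
      with C(3)[OF assms, of "[]"] show ?thesis by auto
    next
      case (Cons a v)
      with that have a: "a < n" "v \<in> lists {..<n}" by auto
      from C(3)[OF this] obtain q where "a # q \<in> S" "prefix v q \<or> prefix q v" by blast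
      with Cons show ?thesis by (intro bexI[of _ "a # q"]) auto
    qed
  qed
  moreover have "S \<noteq> {[]}" using cons by auto
  ultimately show ?L by blast
qed

section \<open>Siblings in the tree\<close>

lemma siblings_tree_iff:
  "siblings (tree_poset n) p q \<longleftrightarrow>
    (\<exists>s\<in>lists {..<n}. \<exists>a<n. \<exists>b<n. p = s @ [a] \<and> q = s @ [b])"
  unfolding siblings_def covers_tree_poset by blast

lemma siblings_tree_singletons:
  "siblings (tree_poset n) [a] [b] \<longleftrightarrow> a < n \<and> b < n"
proof
  assume "a < n \<and> b < n"
  then show "siblings (tree_poset n) [a] [b]"
    unfolding siblings_tree_iff by (intro bexI[of _ "[]"]) auto
qed (auto simp: siblings_tree_iff)

text \<open>If the common parent is the root, both words have length one; otherwise the first letter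
  of the parent is shared and can be stripped. Hence no block mixes two subtrees.\<close>

lemma siblings_tree_Cons_Cons:
  assumes "siblings (tree_poset n) (a # v) (b # w)"
  shows "v = [] \<and> w = [] \<or> a = b \<and> siblings (tree_poset n) v w"
proof -
  obtain s x y where s: "s \<in> lists {..<n}" "x < n" "y < n" "a # v = s @ [x]" "b # w = s @ [y]"
    using assms by (auto simp: siblings_tree_iff)
  then show ?thesis
    by (cases s) (auto simp: siblings_tree_iff)
qed

lemma siblings_tree_ConsI:
  assumes "siblings (tree_poset n) v w" and "a < n"
  shows "siblings (tree_poset n) (a # v) (a # w)"
proof -
  obtain s x y where s: "s \<in> lists {..<n}" "x < n" "y < n" "v = s @ [x]" "w = s @ [y]"
    using assms by (auto simp: siblings_tree_iff)
  then show ?thesis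
    using assms(2) unfolding siblings_tree_iff by (intro bexI[of _ "a # s"]) auto
qed

text \<open>
  \<open>U\<close> is the set of children of the root that lie in the antichain, \<open>Q\<close> the partition of these
  children, and \<open>G a\<close> the partition below the child \<open>a\<close>, with the letter \<open>a\<close> stripped.
\<close>
definition graft ::
  "nat \<Rightarrow> nat set \<times> nat set set \<times> (nat \<Rightarrow> nat list set set) \<Rightarrow> nat list set set" where
  "graft n = (\<lambda>(U, Q, G). (`) (\<lambda>a. [a]) ` Q \<union> (\<Union>a\<in>{..<n} - U. (`) ((#) a) ` G a))"

text \<open>The inverse of \<open>graft\<close>, taking preimages of blocks under the two
  embeddings. Restricting the family to the letters outside \<open>U\<close> makes it extensional,
  as \<open>graft_data\<close> requires.\<close>

definition ungraft ::
  "nat \<Rightarrow> nat list set set \<Rightarrow> nat set \<times> nat set set \<times> (nat \<Rightarrow> nat list set set)" where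
  "ungraft n P = (let U = {a. [a] \<in> \<Union>P} in
     (U, {B. (\<lambda>a. [a]) ` B \<in> P}, \<lambda>a\<in>{..<n} - U. {B. (#) a ` B \<in> P}))"

text \<open>Below a child outside \<open>U\<close> only lower partitions are allowed: the root of
  that subtree is the child itself, whose membership in the antichain is recorded by
  \<open>U\<close>.\<close>

definition graft_data ::
  "nat \<Rightarrow> (nat set \<times> nat set set \<times> (nat \<Rightarrow> nat list set set)) set" where
  "graft_data n = (SIGMA U:Pow {..<n}.
     {Q. partition_on U Q} \<times> (({..<n} - U) \<rightarrow>\<^sub>E lower_DSC_partitions n))"

section \<open>Grafting is a weight-preserving bijection\<close>

lemma lower_DSC_partitionsD:
  assumes "P \<in> lower_DSC_partitions n"
  shows "finite P" "partition_on (\<Union>P) P" "maximal_antichain (tree_poset n) (\<Union>P)"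
    "\<Union>P \<noteq> {[]}" "\<And>B p q. B \<in> P \<Longrightarrow> p \<in> B \<Longrightarrow> q \<in> B \<Longrightarrow> p \<noteq> q \<Longrightarrow> siblings (tree_poset n) p q"
    "[] \<notin> \<Union>P" "{} \<notin> P"
proof -
  show "finite P" "partition_on (\<Union>P) P" "maximal_antichain (tree_poset n) (\<Union>P)"
    "\<Union>P \<noteq> {[]}" "\<And>B p q. B \<in> P \<Longrightarrow> p \<in> B \<Longrightarrow> q \<in> B \<Longrightarrow> p \<noteq> q \<Longrightarrow> siblings (tree_poset n) p q"
    using assms by (auto simp: lower_DSC_partitions_def pairwise_def)
  then show "[] \<notin> \<Union>P" "{} \<notin> P"
    using maximal_antichain_tree_root by (blast, simp add: partition_on_def)
qed

lemma graft_dataD: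
  assumes "(U, Q, G) \<in> graft_data n"
  shows "U \<subseteq> {..<n}" "partition_on U Q" "\<And>a. a < n \<Longrightarrow> a \<notin> U \<Longrightarrow> G a \<in> lower_DSC_partitions n"
    "G \<in> extensional ({..<n} - U)"
proof -
  have "U \<in> Pow {..<n}" and Q: "partition_on U Q"
    and G: "G \<in> ({..<n} - U) \<rightarrow>\<^sub>E lower_DSC_partitions n"
    using assms by (simp_all add: graft_data_def)
  then show "U \<subseteq> {..<n}" "partition_on U Q" by blast+
  show "\<And>a. a < n \<Longrightarrow> a \<notin> U \<Longrightarrow> G a \<in> lower_DSC_partitions n"
    using PiE_mem[OF G] by simp
  show "G \<in> extensional ({..<n} - U)"
    using G by (simp add: PiE_def)
qed

text \<open>The right-hand set contains a word, and all its words have length at least two.\<close>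

lemma singletons_neq_Cons_image:
  assumes "[] \<notin> C" and "C \<noteq> {}"
  shows "(\<lambda>a. [a]) ` B \<noteq> (#) a ` C"
proof
  assume eq: "(\<lambda>a. [a]) ` B = (#) a ` C"
  obtain v where v: "v \<in> C" using assms(2) by blast
  then have "a # v \<in> (\<lambda>a. [a]) ` B" using eq by blast
  with v assms(1) show False by auto
qed

lemma Cons_image_eq_iff:
  assumes "C \<noteq> {}"
  shows "(#) a ` B = (#) b ` C \<longleftrightarrow> a = b \<and> B = C"
proof
  assume eq: "(#) a ` B = (#) b ` C"
  obtain v where "v \<in> C" using assms by blast
  then have "b # v \<in> (#) a ` B" using eq by blast
  then have "a = b" by auto
  with eq show "a = b \<and> B = C" by (simp add: inj_image_eq_iff)
qed simp

lemma inj_image_singletons: "inj ((`) (\<lambda>a. [a]))"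
proof (rule injI)
  fix B C :: "'a set" assume "(\<lambda>a. [a]) ` B = (\<lambda>a. [a]) ` C"
  moreover have "inj (\<lambda>a::'a. [a])" by (rule injI) simp
  ultimately show "B = C" by (simp only: inj_image_eq_iff)
qed

lemma inj_image_Cons: "inj ((`) ((#) a))"
proof (rule injI)
  fix B C assume "(#) a ` B = (#) a ` C"
  moreover have "inj ((#) a)" by (rule injI) simp
  ultimately show "B = C" by (simp only: inj_image_eq_iff)
qed

lemma graft_data_block:
  assumes "(U, Q, G) \<in> graft_data n" and "a < n" and "a \<notin> U" and "B \<in> G a"
  shows "[] \<notin> B" and "B \<noteq> {}"
proof -
  note P = graft_dataD(3)[OF assms(1-3)]
  show "[] \<notin> B" using lower_DSC_partitionsD(6)[OF P] assms(4) by blast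
  show "B \<noteq> {}" using lower_DSC_partitionsD(7)[OF P] assms(4) by metis
qed

text \<open>Determines the slices of the grafted antichain, in the form to which
  \<open>maximal_antichain_tree_Cons_iff\<close> applies.\<close>

lemma Cons_in_Union_graft:
  assumes "(U, Q, G) \<in> graft_data n"
  shows "[] \<notin> \<Union>(graft n (U, Q, G))"
    and "a # v \<in> \<Union>(graft n (U, Q, G)) \<longleftrightarrow>
      (if a \<in> U then v = [] else a < n \<and> v \<in> \<Union>(G a))"
proof -
  have "\<Union>(graft n (U, Q, G)) = (\<lambda>a. [a]) ` \<Union>Q \<union> (\<Union>b\<in>{..<n} - U. (#) b ` \<Union>(G b))"
    unfolding graft_def prod.case by (simp add: image_Union) blast
  then have *: "\<Union>(graft n (U, Q, G)) = (\<lambda>a. [a]) ` U \<union> (\<Union>b\<in>{..<n} - U. (#) b ` \<Union>(G b))"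
    using partition_onD1[OF graft_dataD(2)[OF assms]] by simp
  show "[] \<notin> \<Union>(graft n (U, Q, G))"
    unfolding * by blast
  have "a # v \<in> (\<lambda>a. [a]) ` U \<longleftrightarrow> a \<in> U \<and> v = []"
    by blast
  moreover have "a # v \<in> (\<Union>b\<in>{..<n} - U. (#) b ` \<Union>(G b)) \<longleftrightarrow> a < n \<and> a \<notin> U \<and> v \<in> \<Union>(G a)"
    by blast
  ultimately show "a # v \<in> \<Union>(graft n (U, Q, G)) \<longleftrightarrow>
      (if a \<in> U then v = [] else a < n \<and> v \<in> \<Union>(G a))"
    unfolding * by simp
qed

lemma ungraft_graft:
  assumes "x \<in> graft_data n"
  shows "ungraft n (graft n x) = x"
proof -
  obtain U Q G where x: "x = (U, Q, G)" by (metis prod_cases3)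
  note D = graft_dataD[OF assms[unfolded x]]
  let ?P = "graft n (U, Q, G)"
  have G: "[] \<notin> B" "B \<noteq> {}" if "a < n" "a \<notin> U" "B \<in> G a" for a B
    using graft_data_block[OF assms[unfolded x] that] .
  have Q: "B \<noteq> {}" if "B \<in> Q" for B using partition_onD3[OF D(2)] that by auto
  have "{a. [a] \<in> \<Union>?P} = U"
    unfolding Cons_in_Union_graft[OF assms[unfolded x]]
    using lower_DSC_partitionsD(6)[OF D(3)] by auto
  moreover have "{B. (\<lambda>a. [a]) ` B \<in> ?P} = Q"
  proof -
    have "(\<lambda>a. [a]) ` B \<in> ?P \<longleftrightarrow> B \<in> Q" for B
    proof -
      have "(\<lambda>a. [a]) ` B \<notin> (\<Union>a\<in>{..<n} - U. (`) ((#) a) ` G a)"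
      proof
        assume "(\<lambda>a. [a]) ` B \<in> (\<Union>a\<in>{..<n} - U. (`) ((#) a) ` G a)"
        then obtain a C where C: "a < n" "a \<notin> U" "C \<in> G a" "(\<lambda>a. [a]) ` B = (#) a ` C" by blast
        with singletons_neq_Cons_image[OF G[OF C(1-3)]] show False by blast
      qed
      then show ?thesis
        unfolding graft_def prod.case Un_iff inj_image_mem_iff[OF inj_image_singletons] by blast
    qed
    then show ?thesis by blast
  qed
  moreover have "{B. (#) a ` B \<in> ?P} = G a" if a: "a < n" "a \<notin> U" for a
  proof -
    have "(#) a ` B \<in> ?P \<longleftrightarrow> B \<in> G a" for B
    proof -
      \<comment> \<open>Since \<open>B\<close> is arbitrary here,
        \<open>singletons_neq_Cons_image\<close> does not apply; instead equality would put
        \<open>a\<close> into a block of \<open>Q\<close>, hence into \<open>U\<close>.\<close>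
      have "(#) a ` B \<noteq> (\<lambda>a. [a]) ` C" if C: "C \<in> Q" for C
      proof
        assume eq: "(#) a ` B = (\<lambda>a. [a]) ` C"
        obtain c where c: "c \<in> C" using Q[OF C] by blast
        then have "[c] \<in> (#) a ` B" using eq by blast
        then have "c = a" by auto
        moreover have "c \<in> U" using c C partition_onD1[OF D(2)] by blast
        ultimately show False using a by simp
      qed
      moreover have "(#) a ` B \<in> (\<Union>b\<in>{..<n} - U. (`) ((#) b) ` G b) \<longleftrightarrow> B \<in> G a"
      proof
        assume "(#) a ` B \<in> (\<Union>b\<in>{..<n} - U. (`) ((#) b) ` G b)"
        then obtain b C where C: "b < n" "b \<notin> U" "C \<in> G b" "(#) a ` B = (#) b ` C"
          by blast
        then show "B \<in> G a" using Cons_image_eq_iff[OF G(2)[OF C(1-3)]] by simp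
      qed (use a in blast)
      ultimately show ?thesis
        unfolding graft_def prod.case by blast
    qed
    then show ?thesis by blast
  qed
  moreover have "(\<lambda>a\<in>{..<n} - U. {B. (#) a ` B \<in> ?P}) = G"
    using calculation(3) D(4) by (intro extensionalityI[of _ "{..<n} - U"]) auto
  ultimately show ?thesis
    by (simp add: x ungraft_def Let_def)
qed

lemma finite_graft_data:
  assumes "(U, Q, G) \<in> graft_data n"
  shows "finite U" "finite Q"
proof -
  show "finite U" using graft_dataD(1)[OF assms] finite_subset by blast
  then show "finite Q" using finite_elements graft_dataD(2)[OF assms] by blast
qed

lemma disjnt_graft_parts:
  assumes "(U, Q, G) \<in> graft_data n"
  shows "a < n \<Longrightarrow> a \<notin> U \<Longrightarrow> (`) (\<lambda>a. [a]) ` Q \<inter> (`) ((#) a) ` G a = {}"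
    and "a < n \<Longrightarrow> a \<notin> U \<Longrightarrow> b < n \<Longrightarrow> b \<notin> U \<Longrightarrow> a \<noteq> b \<Longrightarrow> (`) ((#) a) ` G a \<inter> (`) ((#) b) ` G b = {}"
proof -
  note D = graft_dataD[OF assms]
  have G: "[] \<notin> B" "B \<noteq> {}" if "a < n" "a \<notin> U" "B \<in> G a" for a B
    using graft_data_block[OF assms that] .
  show "(`) (\<lambda>a. [a]) ` Q \<inter> (`) ((#) a) ` G a = {}" if "a < n" "a \<notin> U"
  proof -
    have "(\<lambda>a. [a]) ` B \<noteq> (#) a ` C" if "C \<in> G a" for B C
      by (rule singletons_neq_Cons_image[OF G[OF \<open>a < n\<close> \<open>a \<notin> U\<close> that]])
    then show ?thesis by blast
  qed
  show "(`) ((#) a) ` G a \<inter> (`) ((#) b) ` G b = {}" if "a < n" "a \<notin> U" "b < n" "b \<notin> U" "a \<noteq> b"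
  proof -
    have "(#) a ` B \<noteq> (#) b ` C" if "B \<in> G a" "C \<in> G b" for B C
      using Cons_image_eq_iff[OF G(2)[OF \<open>b < n\<close> \<open>b \<notin> U\<close> that(2)]] \<open>a \<noteq> b\<close> by simp
    then show ?thesis by blast
  qed
qed

text \<open>Blocks from different pieces are distinct and both embeddings act injectively on blocks,
  so the weights of the pieces add.\<close>

lemma card_graft:
  assumes "(U, Q, G) \<in> graft_data n"
  shows "finite (graft n (U, Q, G))"
    and "card (graft n (U, Q, G)) = card Q + (\<Sum>a\<in>{..<n} - U. card (G a))"
proof -
  note D = graft_dataD[OF assms]
  have finG: "finite (G a)" if "a \<in> {..<n} - U" for a
    using lower_DSC_partitionsD(1)[OF D(3)] that by auto
  then show "finite (graft n (U, Q, G))"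
    using finite_graft_data[OF assms] by (auto simp: graft_def)
  have "card (graft n (U, Q, G)) =
      card ((`) (\<lambda>a. [a]) ` Q) + card (\<Union>a\<in>{..<n} - U. (`) ((#) a) ` G a)"
    unfolding graft_def prod.case using finite_graft_data[OF assms] finG disjnt_graft_parts(1)[OF assms]
    by (intro card_Un_disjoint) auto
  also have "card (\<Union>a\<in>{..<n} - U. (`) ((#) a) ` G a) = (\<Sum>a\<in>{..<n} - U. card ((`) ((#) a) ` G a))"
    using finG disjnt_graft_parts(2)[OF assms] by (intro card_UN_disjoint) auto
  finally show "card (graft n (U, Q, G)) = card Q + (\<Sum>a\<in>{..<n} - U. card (G a))"
    by (simp add: card_image inj_on_subset[OF inj_image_singletons subset_UNIV]
        inj_on_subset[OF inj_image_Cons subset_UNIV])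
qed

lemma graft_in_lower_DSC_partitions:
  assumes "n > 0" and "x \<in> graft_data n"
  shows "graft n x \<in> lower_DSC_partitions n"
proof -
  obtain U Q G where x: "x = (U, Q, G)" by (metis prod_cases3)
  note x_in = assms(2)[unfolded x]
  note D = graft_dataD[OF x_in] and mem = Cons_in_Union_graft[OF x_in]
  let ?P = "graft n (U, Q, G)"
  \<comment> \<open>An elimination rule by origin: a block comes from \<open>Q\<close> or from
    exactly one piece \<open>G a\<close> through its letter.\<close>
  have blocks: thesis
    if "C \<in> ?P" "\<And>B. C = (\<lambda>a. [a]) ` B \<Longrightarrow> B \<in> Q \<Longrightarrow> thesis"
      "\<And>a B. C = (#) a ` B \<Longrightarrow> a < n \<Longrightarrow> a \<notin> U \<Longrightarrow> B \<in> G a \<Longrightarrow> thesis" for C thesis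
    using that by (auto simp: graft_def)
  have G: "[] \<notin> B" "B \<noteq> {}" if "a < n" "a \<notin> U" "B \<in> G a" for a B
    using graft_data_block[OF x_in that] .
  have QU: "B \<subseteq> U" "B \<noteq> {}" if "B \<in> Q" for B
    using D(2) that by (auto simp: partition_on_def)
  have "{} \<notin> ?P"
  proof
    assume "{} \<in> ?P" then show False
      by (rule blocks) (use G(2) QU(2) in auto)
  qed
  moreover have "C = C'" if C: "C \<in> ?P" "C' \<in> ?P" "p \<in> C" "p \<in> C'" for C C' p
    using C(1)
  proof (rule blocks)
    fix B assume B: "C = (\<lambda>a. [a]) ` B" "B \<in> Q"
    from C(2) show ?thesis
    proof (rule blocks)
      fix B' assume B': "C' = (\<lambda>a. [a]) ` B'" "B' \<in> Q"
      then have "B \<inter> B' \<noteq> {}" using B C by auto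
      then show ?thesis using B B' partition_onD2[OF D(2)] by (auto simp: disjoint_def)
    next
      fix a B' assume "C' = (#) a ` B'" "a < n" "a \<notin> U" "B' \<in> G a"
      then show ?thesis using B C G[of a B'] by auto
    qed
  next
    fix a B assume B: "C = (#) a ` B" "a < n" "a \<notin> U" "B \<in> G a"
    from C(2) show ?thesis
    proof (rule blocks)
      fix B' assume "C' = (\<lambda>a. [a]) ` B'" "B' \<in> Q"
      then show ?thesis using B C G[of a B] by auto
    next
      fix b B' assume B': "C' = (#) b ` B'" "b < n" "b \<notin> U" "B' \<in> G b"
      then have "a = b" "B \<inter> B' \<noteq> {}" using B C by auto
      then show ?thesis
        using B B' partition_onD2[OF lower_DSC_partitionsD(2)[OF D(3)[OF B(2,3)]]]
        by (auto simp: disjoint_def)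
    qed
  qed
  then have "disjoint ?P"
    by (auto simp: disjoint_def)
  moreover have "maximal_antichain (tree_poset n) (\<Union>?P) \<and> \<Union>?P \<noteq> {[]}"
    unfolding maximal_antichain_tree_Cons_iff[OF assms(1)]
  proof (intro conjI ballI allI impI)
    show "\<exists>a<n. \<exists>v. w = a # v" if "w \<in> \<Union>?P" for w
      using that mem D(1) by (cases w) (auto split: if_splits)
    show "maximal_antichain (tree_poset n) {v. a # v \<in> \<Union>?P}" if "a < n" for a
    proof (cases "a \<in> U")
      case True
      then show ?thesis unfolding mem by (auto simp: maximal_antichain_tree_iff)
    next
      case False
      then have "{v. a # v \<in> \<Union>?P} = \<Union>(G a)" unfolding mem using that by auto
      then show ?thesis using lower_DSC_partitionsD(3)[OF D(3)] that False by simp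
    qed
  qed
  moreover have "siblings (tree_poset n) p q" if C: "C \<in> ?P" "p \<in> C" "q \<in> C" "p \<noteq> q" for C p q
    using C(1)
  proof (rule blocks)
    fix B assume B: "C = (\<lambda>a. [a]) ` B" "B \<in> Q"
    then have "B \<subseteq> {..<n}" using QU D(1) by blast
    with B C show ?thesis by (auto simp: siblings_tree_singletons)
  next
    fix a B assume B: "C = (#) a ` B" "a < n" "a \<notin> U" "B \<in> G a"
    then obtain v w where "p = a # v" "q = a # w" "v \<in> B" "w \<in> B" "v \<noteq> w" using C by auto
    with B lower_DSC_partitionsD(5)[OF D(3)[OF B(2,3)]] show ?thesis
      by (auto intro: siblings_tree_ConsI)
  qed
  ultimately show ?thesis
    using card_graft(1)[OF x_in] unfolding x
    by (auto simp: lower_DSC_partitions_def partition_on_def pairwise_def)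
qed

text \<open>Compare all words of the block with one fixed word \<open>w\<close>. By
  \<open>siblings_tree_Cons_Cons\<close>, they all have length one if \<open>w\<close> does, and
  otherwise share its first letter \<open>a\<close>. In the latter case \<open>[a]\<close> is a
  proper prefix of \<open>w\<close>, so the antichain excludes it.\<close>

lemma lower_DSC_partition_block_cases:
  assumes "P \<in> lower_DSC_partitions n" and "C \<in> P"
  obtains B where "C = (\<lambda>a. [a]) ` B"
  | a B where "C = (#) a ` B" and "a < n" and "[a] \<notin> \<Union>P"
proof -
  note D = lower_DSC_partitionsD[OF assms(1)]
  have anti: "p = q" if "p \<in> \<Union>P" "q \<in> \<Union>P" "prefix p q" for p q
    using D(3) that unfolding maximal_antichain_tree_iff by blast
  have cons: "\<exists>a<n. \<exists>v. w = a # v" if "w \<in> C" for w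
  proof -
    have "w \<in> \<Union>P" using that assms(2) by blast
    with D(3,6) have "w \<in> lists {..<n}" "w \<noteq> []"
      by (auto simp: maximal_antichain_tree_iff)
    then show ?thesis by (cases w) auto
  qed
  obtain w where w: "w \<in> C" using D(7) assms(2) by (metis all_not_in_conv)
  from cons[OF this] obtain a v where av: "w = a # v" "a < n" by blast
  have sib: "v' = [] \<and> v = [] \<or> a = b \<and> siblings (tree_poset n) v v'"
    if "b # v' \<in> C" "b # v' \<noteq> w" for b v'
    using siblings_tree_Cons_Cons[of n a v b v'] D(5)[OF assms(2) w that(1)] that(2) av by auto
  show thesis
  proof (cases "v = []")
    case True
    have "\<exists>b. p = [b]" if p: "p \<in> C" for p
    proof -
      obtain b v' where b: "p = b # v'" using cons[OF p] by blast
      have "v' = []" if "p \<noteq> w"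
        using sib[of b v'] p that b True by (auto simp: siblings_tree_iff)
      with b av True show ?thesis by auto
    qed
    then have "C = (\<lambda>a. [a]) ` {a. [a] \<in> C}" by auto
    then show thesis by (rule that(1))
  next
    case False
    have "\<exists>v'. p = a # v'" if p: "p \<in> C" for p
    proof -
      obtain b v' where b: "p = b # v'" using cons[OF p] by blast
      with sib[of b v'] p False av show ?thesis by auto
    qed
    then have "C = (#) a ` {v. a # v \<in> C}" by auto
    moreover have "[a] \<notin> \<Union>P"
      using anti[of "[a]" w] w assms(2) av False by auto
    ultimately show thesis using that(2) av(2) by blast
  qed
qed

lemma ungraft_in_graft_data:
  assumes "n > 0" and "P \<in> lower_DSC_partitions n"
  shows "ungraft n P \<in> graft_data n"
proof -
  note D = lower_DSC_partitionsD[OF assms(2)]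
  define U where "U = {a. [a] \<in> \<Union>P}"
  have disj: "C = C'" if "C \<in> P" "C' \<in> P" "p \<in> C" "p \<in> C'" for C C' p
    using partition_onD2[OF D(2)] that by (auto simp: disjoint_def)
  have MA: "\<exists>a<n. \<exists>v. w = a # v" "maximal_antichain (tree_poset n) {v. a # v \<in> \<Union>P}"
    if "w \<in> \<Union>P" "a < n" for w a
    using maximal_antichain_tree_Cons_iff[OF assms(1), of "\<Union>P"] D(3,4) that by blast+
  have U: "U \<subseteq> {..<n}"
  proof
    fix a assume "a \<in> U"
    then have "[a] \<in> \<Union>P" by (simp add: U_def)
    \<comment> \<open>The \<open>0\<close> supplies the letter below \<open>n\<close> that the
      shared premises of \<open>MA\<close> ask for.\<close>
    then show "a \<in> {..<n}" using MA(1)[of "[a]" 0] assms(1) by auto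
  qed
  have "partition_on U {B. (\<lambda>a. [a]) ` B \<in> P}"
  proof (rule partition_onI)
    show "\<Union> {B. (\<lambda>a. [a]) ` B \<in> P} = U"
    proof (intro equalityI subsetI)
      fix a assume "a \<in> U"
      then obtain C where C: "C \<in> P" "[a] \<in> C" by (auto simp: U_def)
      from assms(2) C(1) show "a \<in> \<Union> {B. (\<lambda>a. [a]) ` B \<in> P}"
      proof (cases rule: lower_DSC_partition_block_cases)
        case (1 B)
        with C show ?thesis by auto
      next
        case (2 b B)
        with C show ?thesis by auto
      qed
    qed (auto simp: U_def)
    show "{} \<notin> {B. (\<lambda>a. [a]) ` B \<in> P}" using D(7) by auto
    show "disjnt B B'" if "B \<in> {B. (\<lambda>a. [a]) ` B \<in> P}" "B' \<in> {B. (\<lambda>a. [a]) ` B \<in> P}" "B \<noteq> B'" for B B'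
    proof (rule ccontr)
      assume "\<not> disjnt B B'"
      then obtain a where "a \<in> B" "a \<in> B'" by (auto simp: disjnt_def)
      with disj[of "(\<lambda>a. [a]) ` B" "(\<lambda>a. [a]) ` B'" "[a]"] that
      have "(\<lambda>a. [a]) ` B = (\<lambda>a. [a]) ` B'" by auto
      then have "B = B'" by (rule injD[OF inj_image_singletons])
      with that(3) show False by simp
    qed
  qed
  moreover have "{B. (#) a ` B \<in> P} \<in> lower_DSC_partitions n" if a: "a < n" "a \<notin> U" for a
  proof -
    let ?G = "{B. (#) a ` B \<in> P}"
    have UG: "\<Union>?G = {v. a # v \<in> \<Union>P}"
    proof (intro equalityI subsetI)
      fix v assume "v \<in> {v. a # v \<in> \<Union>P}"
      then obtain C where C: "C \<in> P" "a # v \<in> C" by auto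
      from assms(2) C(1) show "v \<in> \<Union>?G"
      proof (cases rule: lower_DSC_partition_block_cases)
        case (1 B)
        \<comment> \<open>A block of one-letter words containing \<open>a # v\<close> would contain
          \<open>[a]\<close>, contradicting \<open>a \<notin> U\<close>.\<close>
        with C a show ?thesis by (auto simp: U_def)
      next
        case (2 b B)
        with C show ?thesis by auto
      qed
    qed auto
    have "finite ?G"
      using finite_vimageI[OF D(1) inj_image_Cons] by (simp add: vimage_def)
    moreover have "partition_on (\<Union>?G) ?G"
    proof (rule partition_onI)
      show "{} \<notin> ?G" using D(7) by auto
      show "disjnt B B'" if "B \<in> ?G" "B' \<in> ?G" "B \<noteq> B'" for B B'
      proof (rule ccontr)
        assume "\<not> disjnt B B'"
        then obtain v where "v \<in> B" "v \<in> B'" by (auto simp: disjnt_def)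
        with disj[of "(#) a ` B" "(#) a ` B'" "a # v"] that
        have "(#) a ` B = (#) a ` B'" by auto
        with that(3) show False by (simp add: inj_image_eq_iff)
      qed
    qed simp
    moreover have "maximal_antichain (tree_poset n) (\<Union>?G)"
      unfolding UG using maximal_antichain_tree_Cons_iff[OF assms(1), of "\<Union>P"] D(3,4) a by blast
    moreover have "\<Union>?G \<noteq> {[]}"
      unfolding UG using a by (auto simp: U_def)
    moreover have "siblings (tree_poset n) p q" if "B \<in> ?G" "p \<in> B" "q \<in> B" "p \<noteq> q" for B p q
      using siblings_tree_Cons_Cons[of n a p a q] D(5)[of "(#) a ` B" "a # p" "a # q"] that by auto
    ultimately show ?thesis
      by (auto simp: lower_DSC_partitions_def pairwise_def)
  qed
  ultimately show ?thesis
    using U unfolding ungraft_def Let_def U_def[symmetric] graft_data_def by auto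
qed

text \<open>Only blocks of \<open>P\<close> are reassembled; none is lost, since
  \<open>lower_DSC_partition_block_cases\<close> places each block in the image of one of the
  embeddings.\<close>

lemma graft_ungraft:
  assumes "P \<in> lower_DSC_partitions n"
  shows "graft n (ungraft n P) = P"
proof (intro equalityI subsetI)
  fix C assume "C \<in> graft n (ungraft n P)"
  then show "C \<in> P" by (auto simp: graft_def ungraft_def Let_def)
next
  fix C assume "C \<in> P"
  with assms show "C \<in> graft n (ungraft n P)"
  proof (cases rule: lower_DSC_partition_block_cases)
    case (1 B)
    with \<open>C \<in> P\<close> show ?thesis by (auto simp: graft_def ungraft_def Let_def)
  next
    case (2 a B)
    then have "B \<in> {B. (#) a ` B \<in> P}" using \<open>C \<in> P\<close> by simp
    with 2 have "C \<in> (\<Union>a\<in>{..<n} - {a. [a] \<in> \<Union>P}. (`) ((#) a) ` {B. (#) a ` B \<in> P})"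
      by blast
    then show ?thesis by (simp add: graft_def ungraft_def Let_def)
  qed
qed

lemma bij_betw_graft:
  assumes "n > 0"
  shows "bij_betw (graft n) (graft_data n) (lower_DSC_partitions n)"
  by (rule bij_betw_byWitness[where f' = "ungraft n"])
    (auto simp: ungraft_graft graft_ungraft graft_in_lower_DSC_partitions ungraft_in_graft_data assms)

section \<open>The functional equation\<close>

theorem theorem1:
  fixes n :: nat
  assumes "n \<ge> 2"
  shows "lower_DSC_gf n =
    (\<Sum>u\<le>n. of_nat (n choose u) * fps_of_poly (touchard u) * lower_DSC_gf n ^ (n - u))"
proof -
  let ?L = "lower_DSC_partitions n"
  let ?D = "\<lambda>U. {Q. partition_on U Q} \<times> (({..<n} - U) \<rightarrow>\<^sub>E ?L)"
  \<comment> \<open>The number of blocks after grafting, by \<open>card_graft\<close>. For fixed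
    \<open>U\<close> it is a sum over independent components, so \<open>ogf_times\<close> and
    \<open>ogf_PiE\<close> apply.\<close>
  let ?w = "\<lambda>U (Q, G). card Q + (\<Sum>a\<in>{..<n} - U. card (G a))"
  have gf: "lower_DSC_gf n = ogf ?L card"
    by (rule fps_ext) (simp add: lower_DSC_gf_def num_lower_DSCs_eq)
  note fin = finite_fibres_lower_DSC_partitions[OF assms]
  have part: "finite_fibres {Q. partition_on U Q} card" if "U \<in> Pow {..<n}" for U
    using finitely_many_partition_on[of U] that finite_subset[of U "{..<n}"]
    by (auto simp: finite_fibres_def)
  have pow: "finite_fibres (({..<n} - U) \<rightarrow>\<^sub>E ?L) (\<lambda>G. \<Sum>a\<in>{..<n} - U. card (G a))"
    "ogf (({..<n} - U) \<rightarrow>\<^sub>E ?L) (\<lambda>G. \<Sum>a\<in>{..<n} - U. card (G a)) = ogf ?L card ^ card ({..<n} - U)" for U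
    using ogf_PiE[OF _ fin, of "{..<n} - U"] by simp_all
  have "ogf ?L card = ogf (graft_data n) (\<lambda>(U, x). ?w U x)"
    by (rule ogf_bij[symmetric, OF bij_betw_graft]) (use assms card_graft(2) in auto)
  also have "\<dots> = (\<Sum>U\<in>Pow {..<n}. ogf (?D U) (?w U))"
    unfolding graft_data_def using finite_fibres_times[OF part pow(1)] by (intro ogf_Sigma) auto
  also have "\<dots> = (\<Sum>U\<in>Pow {..<n}. fps_of_poly (touchard (card U)) * ogf ?L card ^ (n - card U))"
  proof (rule sum.cong[OF refl])
    fix U assume U: "U \<in> Pow {..<n}"
    then have "finite U" using finite_subset by blast
    moreover have "card ({..<n} - U) = n - card U"
      using U \<open>finite U\<close> by (simp add: card_Diff_subset)
    ultimately show "ogf (?D U) (?w U) = fps_of_poly (touchard (card U)) * ogf ?L card ^ (n - card U)"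
      using ogf_times[OF part[OF U] pow(1)] pow(2) ogf_partition_on[OF \<open>finite U\<close>] by simp
  qed
  \<comment> \<open>The summand depends on \<open>U\<close> only through
    \<open>card U\<close>.\<close>
  also have "\<dots> = (\<Sum>u\<le>n. of_nat (n choose u) * (fps_of_poly (touchard u) * ogf ?L card ^ (n - u)))"
    using sum_Pow_card[of "{..<n}"] by simp
  finally show ?thesis
    by (simp add: gf mult.assoc)
qed

end
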